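(* For every $H\in[0,1]$, the function $t\mapsto\mathsf{V}(H,t)$ is strictly increasing on $[0,\infty)$.
   Context: For $H\in(0,1)$, $B^H=\{B^H_t, t\ge 0\}$ is a fractional Brownian motion with Hurst index $H$: a zero-mean Gaussian process (with continuous paths) with covariance $\mathsf{E}B^H_tB^H_s=\frac12(t^{2H}+s^{2H}-|t-s|^{2H})$. Define $X^H_t=\int_0^t e^s\,dB^H_s = e^tB^H_t-\int_0^t e^sB^H_s\,ds$, $t\ge 0$, and $\mathsf{V}(H,t)=\mathsf{E}(X^H_t)^2$. For the boundary values the process is extended (by limits of covariances) so that $\mathsf{V}(0,t)=\frac{e^{2t}+1}{2}$ for $t>0$, $\mathsf{V}(0,0)=0$, and $\mathsf{V}(1,t)=(e^t-1)^2$. *)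

theory Defs
  imports "HOL-Probability.Probability"
begin

text \<open>Gaussian laws may be degenerate: a point mass counts as normal with variance 0. This is
  needed for Gaussian processes, whose linear combinations can be almost surely constant.\<close>

definition gaussian_rv :: "'a measure \<Rightarrow> ('a \<Rightarrow> real) \<Rightarrow> bool" where
  "gaussian_rv M Y \<longleftrightarrow> Y \<in> borel_measurable M \<and>
     ((\<exists>\<mu>. AE \<omega> in M. Y \<omega> = \<mu>) \<or>
      (\<exists>\<mu> \<sigma>. 0 < \<sigma> \<and> distributed M lborel Y (\<lambda>x. ennreal (normal_density \<mu> \<sigma> x))))"

definition gaussian_process ::
  "'a measure \<Rightarrow> 'i set \<Rightarrow> ('i \<Rightarrow> 'a \<Rightarrow> real) \<Rightarrow> bool" where
  "gaussian_process M T Y \<longleftrightarrow>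
     (\<forall>I c. finite I \<and> I \<subseteq> T \<longrightarrow> gaussian_rv M (\<lambda>\<omega>. \<Sum>i\<in>I. c i * Y i \<omega>))"

text \<open>Time is \<open>{0..}\<close>; values of the process at negative times are unconstrained.\<close>

definition fractional_brownian_motion ::
  "'a measure \<Rightarrow> real \<Rightarrow> (real \<Rightarrow> 'a \<Rightarrow> real) \<Rightarrow> bool" where
  "fractional_brownian_motion M H B \<longleftrightarrow>
     prob_space M \<and>
     gaussian_process M {0..} B \<and>
     (\<forall>\<omega>\<in>space M. continuous_on {0..} (\<lambda>t. B t \<omega>)) \<and>
     (\<forall>t\<ge>0. (\<integral>\<omega>. B t \<omega> \<partial>M) = 0) \<and>
     (\<forall>t\<ge>0. \<forall>s\<ge>0. (\<integral>\<omega>. B t \<omega> * B s \<omega> \<partial>M) =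
        (t powr (2 * H) + s powr (2 * H) - \<bar>t - s\<bar> powr (2 * H)) / 2)"

text \<open>The Wiener integral of \<open>exp\<close> over \<open>[0, t]\<close> against \<open>B\<close>, defined pathwise through
  integration by parts.\<close>

definition X :: "(real \<Rightarrow> 'a \<Rightarrow> real) \<Rightarrow> real \<Rightarrow> 'a \<Rightarrow> real" where
  "X B t \<omega> = exp t * B t \<omega> - (LBINT s:{0..t}. exp s * B s \<omega>)"

text \<open>At \<open>H = 0\<close> and \<open>H = 1\<close> the value is the extension by limits of covariances, and \<open>M\<close>
  and \<open>B\<close> are irrelevant; otherwise \<open>B\<close> is meant to be a fractional Brownian motion on \<open>M\<close>
  with Hurst index \<open>H\<close>.\<close>

definition V :: "'a measure \<Rightarrow> (real \<Rightarrow> 'a \<Rightarrow> real) \<Rightarrow> real \<Rightarrow> real \<Rightarrow> real" where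
  "V M B H t =
     (if H = 0 then (if t = 0 then 0 else (exp (2 * t) + 1) / 2)
      else if H = 1 then (exp t - 1)\<^sup>2
      else (\<integral>\<omega>. (X B t \<omega>)\<^sup>2 \<partial>M))"

end

theory Submission
  imports Defs
begin

text \<open>Write \<open>a = 2 * H\<close>. The reason for the monotonicity is the closed form, for \<open>0 < H < 1\<close>,
  \<open>V(H, t) = exp t * t powr a\<close> plus one half of the integral over \<open>v \<in> {0..t}\<close> of
  \<open>(exp (2 * t - v) - exp v) * v powr a\<close>.
  The first summand is strictly increasing in \<open>t\<close>. The second is nondecreasing, since its integrand
  is nonnegative on \<open>{0..t}\<close> and grows with \<open>t\<close>; expressed by derivatives, the derivative of the
  integral is \<open>2 * exp (2 * t)\<close> times the integral of \<open>exp (- v) * v powr a\<close>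
  (\<open>exp_moment_combination_mono\<close>). At \<open>H = 0\<close> and \<open>H = 1\<close> the explicit boundary values decide.

  The closed form (\<open>fBm_second_moment\<close>) comes from the covariance alone. For \<open>t > 0\<close> the two terms
  of \<open>X\<close> merge into a single pathwise integral over \<open>{0..t}\<close> of
  \<open>exp t / t * B t - exp s * B s\<close>, so by Fubini's theorem its second moment is the double
  integral of the covariance of that integrand (\<open>second_moment_of_integral\<close>). Fubini's theorem needs
  joint measurability in time and chance, which follows from path continuity
  (\<open>continuous_paths_jointly_measurable\<close>), and finite second moments, which follow from
  Gaussianity (\<open>gaussian_rv_square_integrable\<close>). The remaining double integral, of
  \<open>exp (s + u) * \<bar>s - u\<bar> powr a\<close>, is evaluated by exhibiting primitives in terms of the two
  functions \<open>lower_exp_moment\<close> and \<open>upper_exp_moment\<close>, one variable at a time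
  (\<open>has_integral_exp_abs_diff\<close> and \<open>has_integral_exp_abs_diff_outer\<close>).\<close>

section \<open>Integrals of exponentials against powers\<close>

text \<open>The lower incomplete Gamma function at \<open>a + 1\<close>, and its analogue with the opposite sign in
  the exponent.\<close>

definition lower_exp_moment :: "real \<Rightarrow> real \<Rightarrow> real" where
  "lower_exp_moment a x = integral {0..x} (\<lambda>v. exp (- v) * v powr a)"

definition upper_exp_moment :: "real \<Rightarrow> real \<Rightarrow> real" where
  "upper_exp_moment a x = integral {0..x} (\<lambda>v. exp v * v powr a)"

lemma continuous_on_powr_nonneg:
  fixes a :: real
  assumes "0 < a" and "continuous_on S f" and "\<And>x. x \<in> S \<Longrightarrow> 0 \<le> f x"
  shows "continuous_on S (\<lambda>x. f x powr a)"
  using assms by (intro continuous_on_powr') (auto intro: continuous_intros)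

lemma primitive_of_continuous:
  fixes g :: "real \<Rightarrow> real"
  assumes "continuous_on {0..} g"
  shows "continuous_on {0..x} (\<lambda>x. integral {0..x} g)"
    and "0 < x \<Longrightarrow> ((\<lambda>x. integral {0..x} g) has_real_derivative g x) (at x)"
proof -
  have c: "continuous_on {0..y} g" for y
    using assms by (rule continuous_on_subset) auto
  show "continuous_on {0..x} (\<lambda>x. integral {0..x} g)"
    by (intro indefinite_integral_continuous_1 integrable_continuous_interval c)
  assume "0 < x"
  have "((\<lambda>x. integral {0..x} g) has_real_derivative g x) (at x within {0..x + 1})"
    using \<open>0 < x\<close> by (intro integral_has_real_derivative c) auto
  moreover have "at x within {0..x + 1} = at x"
    using \<open>0 < x\<close> by (intro at_within_interior) auto
  ultimately show "((\<lambda>x. integral {0..x} g) has_real_derivative g x) (at x)"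
    by simp
qed

lemma
  assumes a: "0 < a"
  shows continuous_lower: "continuous_on {0..x} (lower_exp_moment a)"
    and continuous_upper: "continuous_on {0..x} (upper_exp_moment a)"
    and deriv_lower: "0 < x \<Longrightarrow>
      (lower_exp_moment a has_real_derivative exp (- x) * x powr a) (at x)"
    and deriv_upper: "0 < x \<Longrightarrow>
      (upper_exp_moment a has_real_derivative exp x * x powr a) (at x)"
proof -
  have l: "continuous_on {0..} (\<lambda>v. exp (- v) * v powr a)"
    using a by (intro continuous_intros continuous_on_powr_nonneg) auto
  have u: "continuous_on {0..} (\<lambda>v. exp v * v powr a)"
    using a by (intro continuous_intros continuous_on_powr_nonneg) auto
  have L: "lower_exp_moment a = (\<lambda>x. integral {0..x} (\<lambda>v. exp (- v) * v powr a))"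
    and U: "upper_exp_moment a = (\<lambda>x. integral {0..x} (\<lambda>v. exp v * v powr a))"
    by (auto simp: lower_exp_moment_def upper_exp_moment_def)
  show "continuous_on {0..x} (lower_exp_moment a)"
    unfolding L by (rule primitive_of_continuous[OF l])
  show "continuous_on {0..x} (upper_exp_moment a)"
    unfolding U by (rule primitive_of_continuous[OF u])
  show "0 < x \<Longrightarrow> (lower_exp_moment a has_real_derivative exp (- x) * x powr a) (at x)"
    unfolding L by (rule primitive_of_continuous[OF l])
  show "0 < x \<Longrightarrow> (upper_exp_moment a has_real_derivative exp x * x powr a) (at x)"
    unfolding U by (rule primitive_of_continuous[OF u])
qed

lemma exp_moments_at_0 [simp]: "lower_exp_moment a 0 = 0" "upper_exp_moment a 0 = 0"
  by (simp_all add: lower_exp_moment_def upper_exp_moment_def)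

lemma ftc_real_interior:
  fixes f f' :: "real \<Rightarrow> real"
  assumes "a \<le> b" and "continuous_on {a..b} f"
    and "\<And>x. a < x \<Longrightarrow> x < b \<Longrightarrow> (f has_real_derivative f' x) (at x)"
  shows "(f' has_integral (f b - f a)) {a..b}"
  using assms
  by (intro fundamental_theorem_of_calculus_interior)
    (auto simp: has_real_derivative_iff_has_vector_derivative)

lemma has_integral_exp: "0 \<le> t \<Longrightarrow> (exp has_integral (exp t - 1)) {0..t::real}"
  using ftc_real_interior[of 0 t exp exp] by (simp add: DERIV_exp continuous_on_exp)

lemma has_integral_upper:
  assumes "0 < a" "0 \<le> t"
  shows "((\<lambda>v. exp v * v powr a) has_integral upper_exp_moment a t) {0..t}"
  using ftc_real_interior[OF \<open>0 \<le> t\<close> continuous_upper[OF \<open>0 < a\<close>] deriv_upper[OF \<open>0 < a\<close>]]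
  by simp

text \<open>The integral is split at \<open>u = s\<close>, where the absolute value has its kink. To the left of it
  the substitution \<open>v = s - u\<close> produces the weight \<open>exp (- v)\<close>, to the right of it
  \<open>v = u - s\<close> produces \<open>exp v\<close>; this is why both moment functions occur. Primitives that are
  differentiable in the open interval suffice, so the possibly singular derivative of \<open>v powr a\<close> at
  \<open>v = 0\<close> never enters.\<close>

lemma has_integral_exp_abs_diff:
  assumes a: "0 < a" and s: "0 \<le> s" "s \<le> t"
  shows "((\<lambda>u. exp u * \<bar>s - u\<bar> powr a) has_integral
    exp s * (lower_exp_moment a s + upper_exp_moment a (t - s))) {0..t}"
proof -
  have "((\<lambda>u. exp u * \<bar>s - u\<bar> powr a) has_integral
      (- exp s * lower_exp_moment a (s - s) - - exp s * lower_exp_moment a (s - 0))) {0..s}"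
  proof (rule ftc_real_interior[OF s(1)])
    show "continuous_on {0..s} (\<lambda>u. - exp s * lower_exp_moment a (s - u))"
      by (intro continuous_intros continuous_on_compose2[OF continuous_lower[OF a, of s]]) auto
    fix u assume "0 < u" "u < s"
    then show "((\<lambda>u. - exp s * lower_exp_moment a (s - u)) has_real_derivative
        exp u * \<bar>s - u\<bar> powr a) (at u)"
      by (auto intro!: derivative_eq_intros DERIV_chain2[OF deriv_lower[OF a]]
          simp: exp_diff exp_minus field_simps)
  qed
  moreover have "((\<lambda>u. exp u * \<bar>s - u\<bar> powr a) has_integral
      (exp s * upper_exp_moment a (t - s) - exp s * upper_exp_moment a (s - s))) {s..t}"
  proof (rule ftc_real_interior[OF s(2)])
    show "continuous_on {s..t} (\<lambda>u. exp s * upper_exp_moment a (u - s))"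
      by (intro continuous_intros continuous_on_compose2[OF continuous_upper[OF a, of "t - s"]]) auto
    fix u assume "s < u" "u < t"
    then show "((\<lambda>u. exp s * upper_exp_moment a (u - s)) has_real_derivative
        exp u * \<bar>s - u\<bar> powr a) (at u)"
      by (auto intro!: derivative_eq_intros DERIV_chain2[OF deriv_upper[OF a]]
          simp: exp_diff field_simps)
  qed
  ultimately show ?thesis
    using has_integral_combine[OF s] by (fastforce simp: distrib_left)
qed

text \<open>The integrals of \<open>exp (2 * s)\<close> against the lower and against the reflected upper moment are
  equal, as the double integral is symmetric about the diagonal. Partial integration gives the
  primitive \<open>(exp (2 * s) * lower_exp_moment a s - upper_exp_moment a s) / 2\<close> of the first
  integrand, and similarly for the second; the explicit primitive below is their sum.\<close>

lemma has_integral_exp_abs_diff_outer: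
  assumes a: "0 < a" and t: "0 \<le> t"
  shows "((\<lambda>s. exp s * (exp s * (lower_exp_moment a s + upper_exp_moment a (t - s))))
    has_integral exp (2 * t) * lower_exp_moment a t - upper_exp_moment a t) {0..t}"
proof -
  let ?P = "\<lambda>s. (exp (2 * s) * lower_exp_moment a s - upper_exp_moment a s
    + exp (2 * s) * upper_exp_moment a (t - s) - exp (2 * t) * lower_exp_moment a (t - s)) / 2"
  have "((\<lambda>s. exp s * (exp s * (lower_exp_moment a s + upper_exp_moment a (t - s))))
    has_integral ?P t - ?P 0) {0..t}"
  proof (rule ftc_real_interior[OF t])
    show "continuous_on {0..t} ?P"
      by (intro continuous_intros continuous_lower[OF a] continuous_upper[OF a]
          continuous_on_compose2[OF continuous_upper[OF a, of t]]
          continuous_on_compose2[OF continuous_lower[OF a, of t]]) auto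
    fix s assume "0 < s" "s < t"
    then have st: "0 < s" "0 < t - s" by auto
    have e: "exp (2 * x) = exp x * exp x" "exp (x * 2) = exp x * exp x" for x :: real
      by (simp_all flip: exp_add)
    show "(?P has_real_derivative
        exp s * (exp s * (lower_exp_moment a s + upper_exp_moment a (t - s)))) (at s)"
      by (rule derivative_eq_intros deriv_lower[OF a] deriv_upper[OF a] 
          DERIV_chain2[OF deriv_upper[OF a]] DERIV_chain2[OF deriv_lower[OF a]] refl st)+
        (simp_all add: e exp_diff exp_minus field_simps)
  qed
  then show ?thesis by (simp add: diff_divide_distrib mult.commute)
qed

section \<open>Second moments of pathwise integrals\<close>

text \<open>Needed separately because the covariance identity does not by itself give integrability: the
  Bochner integral of a function that is not integrable is 0, which is also the prescribed second
  moment at time 0.\<close>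

lemma gaussian_rv_square_integrable:
  assumes "prob_space M" and "gaussian_rv M Y"
  shows "integrable M (\<lambda>\<omega>. (Y \<omega>)\<^sup>2)"
proof -
  interpret prob_space M by fact
  have [measurable]: "Y \<in> borel_measurable M"
    using assms(2) by (simp add: gaussian_rv_def)
  from assms(2) consider
      (const) \<mu> where "AE \<omega> in M. Y \<omega> = \<mu>"
    | (normal) \<mu> \<sigma> where "0 < \<sigma>" 
        "distributed M lborel Y (\<lambda>x. ennreal (normal_density \<mu> \<sigma> x))"
    unfolding gaussian_rv_def by blast
  then show ?thesis
  proof cases
    case const
    have "integrable M (\<lambda>\<omega>. (Y \<omega>)\<^sup>2) \<longleftrightarrow> integrable M (\<lambda>\<omega>. \<mu>\<^sup>2)"
      using const by (intro integrable_cong_AE) auto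
    then show ?thesis by simp
  next
    case normal
    have "integrable lborel (\<lambda>x. normal_density \<mu> \<sigma> x * (x - \<mu>)\<^sup>2
        + 2 * \<mu> * (normal_density \<mu> \<sigma> x * (x - \<mu>)^1)
        + \<mu>\<^sup>2 * (normal_density \<mu> \<sigma> x * (x - \<mu>)^0))"
      using normal(1)
      by (intro Bochner_Integration.integrable_add integrable_mult_right integrable_normal_moment)
    also have "(\<lambda>x. normal_density \<mu> \<sigma> x * (x - \<mu>)\<^sup>2
        + 2 * \<mu> * (normal_density \<mu> \<sigma> x * (x - \<mu>)^1)
        + \<mu>\<^sup>2 * (normal_density \<mu> \<sigma> x * (x - \<mu>)^0)) = (\<lambda>x. normal_density \<mu> \<sigma> x * x\<^sup>2)"
      by (auto simp: power2_eq_square algebra_simps)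
    finally show ?thesis
      by (subst (asm) distributed_integrable[OF normal(2)]) auto
  qed
qed

lemma integrable_mult_of_squares:
  fixes f g :: "'a \<Rightarrow> real"
  assumes [measurable]: "f \<in> borel_measurable M" "g \<in> borel_measurable M"
    and "integrable M (\<lambda>x. (f x)\<^sup>2)" "integrable M (\<lambda>x. (g x)\<^sup>2)"
  shows "integrable M (\<lambda>x. f x * g x)"
    and "(\<integral>x. \<bar>f x * g x\<bar> \<partial>M) \<le> ((\<integral>x. (f x)\<^sup>2 \<partial>M) + (\<integral>x. (g x)\<^sup>2 \<partial>M)) / 2"
proof -
  have i: "integrable M (\<lambda>x. ((f x)\<^sup>2 + (g x)\<^sup>2) / 2)"
    using assms by auto
  have le: "\<bar>f x * g x\<bar> \<le> ((f x)\<^sup>2 + (g x)\<^sup>2) / 2" for x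
    using sum_squares_bound[of "\<bar>f x\<bar>" "\<bar>g x\<bar>"] by (simp add: abs_mult)
  show fg: "integrable M (\<lambda>x. f x * g x)"
    by (rule Bochner_Integration.integrable_bound[OF i]) (use le in \<open>auto intro: order_trans\<close>)
  have "(\<integral>x. \<bar>f x * g x\<bar> \<partial>M) \<le> (\<integral>x. ((f x)\<^sup>2 + (g x)\<^sup>2) / 2 \<partial>M)"
    using fg by (intro integral_mono i le) auto
  then show "(\<integral>x. \<bar>f x * g x\<bar> \<partial>M) \<le> ((\<integral>x. (f x)\<^sup>2 \<partial>M) + (\<integral>x. (g x)\<^sup>2 \<partial>M)) / 2"
    using assms by simp
qed

text \<open>The square of the inner integral is an integral over pairs \<open>(s, u)\<close>, and the uniform bound
  \<open>C\<close> makes the product \<open>Y s \<omega> * Y u \<omega>\<close> integrable on the triple product, so that the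
  expectation may be moved inside.\<close>

lemma second_moment_of_integral:
  fixes Y :: "'s \<Rightarrow> 'a \<Rightarrow> real"
  assumes "finite_measure N" and "sigma_finite_measure M"
    and meas [measurable]: "(\<lambda>(s, \<omega>). Y s \<omega>) \<in> borel_measurable (N \<Otimes>\<^sub>M M)"
    and sq: "\<And>s. s \<in> space N \<Longrightarrow> integrable M (\<lambda>\<omega>. (Y s \<omega>)\<^sup>2)"
    and C: "\<And>s. s \<in> space N \<Longrightarrow> (\<integral>\<omega>. (Y s \<omega>)\<^sup>2 \<partial>M) \<le> C"
  shows "(\<integral>\<omega>. (\<integral>s. Y s \<omega> \<partial>N)\<^sup>2 \<partial>M) = (\<integral>s. (\<integral>u. (\<integral>\<omega>. Y s \<omega> * Y u \<omega> \<partial>M) \<partial>N) \<partial>N)"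
proof -
  interpret N: finite_measure N by fact
  interpret M: sigma_finite_measure M by fact
  interpret NN: pair_sigma_finite N N ..
  interpret NNf: finite_measure "N \<Otimes>\<^sub>M N"
    by (intro finite_measure_pair_measure assms)
  have NN_sf: "sigma_finite_measure (N \<Otimes>\<^sub>M N)" ..
  interpret NNM: pair_sigma_finite "N \<Otimes>\<^sub>M N" M ..
  let ?h = "\<lambda>p \<omega>. Y (fst p) \<omega> * Y (snd p) \<omega>"
  have Y_meas [measurable]: "Y s \<in> borel_measurable M" if "s \<in> space N" for s
    using measurable_compose[OF measurable_Pair1'[OF that] meas] by simp
  have h [measurable]: "case_prod ?h \<in> borel_measurable ((N \<Otimes>\<^sub>M N) \<Otimes>\<^sub>M M)"
  proof -
    have "(\<lambda>q. (\<lambda>(s, \<omega>). Y s \<omega>) (fst (fst q), snd q) * (\<lambda>(s, \<omega>). Y s \<omega>) (snd (fst q), snd q))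
        \<in> borel_measurable ((N \<Otimes>\<^sub>M N) \<Otimes>\<^sub>M M)"
      by (intro borel_measurable_times measurable_compose[OF _ meas]) measurable
    then show ?thesis by (simp add: case_prod_unfold)
  qed
  have pair: "integrable M (?h p)" "(\<integral>\<omega>. \<bar>?h p \<omega>\<bar> \<partial>M) \<le> C" if "p \<in> space (N \<Otimes>\<^sub>M N)" for p
  proof -
    have p: "fst p \<in> space N" "snd p \<in> space N"
      using that by (auto simp: space_pair_measure)
    note * = integrable_mult_of_squares[OF Y_meas[OF p(1)] Y_meas[OF p(2)] sq[OF p(1)] sq[OF p(2)]]
    show "integrable M (?h p)" by (rule *)
    show "(\<integral>\<omega>. \<bar>?h p \<omega>\<bar> \<partial>M) \<le> C"
      using *(2) C[OF p(1)] C[OF p(2)] by simp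
  qed
  have int: "integrable ((N \<Otimes>\<^sub>M N) \<Otimes>\<^sub>M M) (case_prod ?h)"
  proof (rule NNM.Fubini_integrable[OF h])
    show "integrable (N \<Otimes>\<^sub>M N) (\<lambda>p. \<integral>\<omega>. norm (case_prod ?h (p, \<omega>)) \<partial>M)"
    proof (rule NNf.integrable_const_bound[where B = C])
      show "AE p in N \<Otimes>\<^sub>M N. norm (\<integral>\<omega>. norm (case_prod ?h (p, \<omega>)) \<partial>M) \<le> C"
        by (rule AE_I2) (use pair(2) in simp)
    qed measurable
    show "AE p in N \<Otimes>\<^sub>M N. integrable M (\<lambda>\<omega>. case_prod ?h (p, \<omega>))"
      by (rule AE_I2) (use pair(1) in simp)
  qed
  have sections: "AE \<omega> in M. integrable (N \<Otimes>\<^sub>M N) (\<lambda>p. ?h p \<omega>)"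
    using NNM.AE_integrable_snd[OF int] by simp
  have "(\<integral>\<omega>. (\<integral>s. Y s \<omega> \<partial>N)\<^sup>2 \<partial>M) = (\<integral>\<omega>. (\<integral>p. ?h p \<omega> \<partial>(N \<Otimes>\<^sub>M N)) \<partial>M)"
  proof (rule integral_cong_AE)
    show "AE \<omega> in M. (\<integral>s. Y s \<omega> \<partial>N)\<^sup>2 = (\<integral>p. ?h p \<omega> \<partial>(N \<Otimes>\<^sub>M N))"
      using sections
    proof eventually_elim
      fix \<omega> assume "integrable (N \<Otimes>\<^sub>M N) (\<lambda>p. ?h p \<omega>)"
      then show "(\<integral>s. Y s \<omega> \<partial>N)\<^sup>2 = (\<integral>p. ?h p \<omega> \<partial>(N \<Otimes>\<^sub>M N))"
        by (subst NN.integral_fst'[symmetric]) (simp_all add: power2_eq_square)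
    qed
    have "(\<lambda>(\<omega>, s). Y s \<omega>) \<in> borel_measurable (M \<Otimes>\<^sub>M N)"
      using measurable_compose[OF measurable_pair_swap' meas] by (simp add: case_prod_unfold)
    then show "(\<lambda>\<omega>. (\<integral>s. Y s \<omega> \<partial>N)\<^sup>2) \<in> borel_measurable M"
      by (intro borel_measurable_power N.borel_measurable_lebesgue_integral)
    have "(\<lambda>(\<omega>, p). ?h p \<omega>) \<in> borel_measurable (M \<Otimes>\<^sub>M (N \<Otimes>\<^sub>M N))"
      using measurable_compose[OF measurable_pair_swap' h] by (simp add: case_prod_unfold)
    then show "(\<lambda>\<omega>. \<integral>p. ?h p \<omega> \<partial>(N \<Otimes>\<^sub>M N)) \<in> borel_measurable M"
      by (rule sigma_finite_measure.borel_measurable_lebesgue_integral[OF NN_sf])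
  qed
  also have "\<dots> = (\<integral>p. (\<integral>\<omega>. ?h p \<omega> \<partial>M) \<partial>(N \<Otimes>\<^sub>M N))"
    by (rule NNM.Fubini_integral[OF int])
  also have "\<dots> = (\<integral>s. (\<integral>u. (\<integral>\<omega>. Y s \<omega> * Y u \<omega> \<partial>M) \<partial>N) \<partial>N)"
    using NNM.integrable_fst'[OF int] by (subst NN.integral_fst'[symmetric]) simp_all
  finally show ?thesis .
qed

text \<open>On each cell of a grid of mesh \<open>1 / Suc n\<close> the process is frozen at the left end point.
  Such a step process takes only countably many of the random variables \<open>B t\<close>, hence is jointly
  measurable, and path continuity makes these processes converge pointwise. Left end points
  keep the grid within the time set \<open>{0..}\<close>. The change of time \<open>f\<close> carries the case where
  time ranges over a smaller interval.\<close>

lemma continuous_paths_jointly_measurable: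
  fixes B :: "real \<Rightarrow> 'a \<Rightarrow> real"
  assumes [measurable]: "\<And>t. 0 \<le> t \<Longrightarrow> B t \<in> borel_measurable M"
    and paths: "\<And>\<omega>. \<omega> \<in> space M \<Longrightarrow> continuous_on {0..} (\<lambda>t. B t \<omega>)"
    and f [measurable]: "f \<in> borel_measurable N" and "\<And>x. x \<in> space N \<Longrightarrow> 0 \<le> f x"
  shows "(\<lambda>(x, \<omega>). B (f x) \<omega>) \<in> borel_measurable (N \<Otimes>\<^sub>M M)"
proof -
  define grid :: "nat \<Rightarrow> real \<Rightarrow> nat" where "grid n x = nat \<lfloor>x * Suc n\<rfloor>" for n x
  show ?thesis
  proof (rule borel_measurable_LIMSEQ_real)
    fix n
    show "(\<lambda>(x, \<omega>). B (real (grid n (f x)) / Suc n) \<omega>) \<in> borel_measurable (N \<Otimes>\<^sub>M M)"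
      unfolding case_prod_unfold
    proof (rule measurable_compose_countable
        [where f = "\<lambda>i q. B (real i / Suc n) (snd q)" and g = "\<lambda>q. grid n (f (fst q))"])
      fix i :: nat
      show "(\<lambda>q. B (real i / Suc n) (snd q)) \<in> borel_measurable (N \<Otimes>\<^sub>M M)"
        by simp
      show "(\<lambda>q. grid n (f (fst q))) \<in> measurable (N \<Otimes>\<^sub>M M) (count_space UNIV)"
        unfolding grid_def by measurable
    qed
  next
    fix q assume "q \<in> space (N \<Otimes>\<^sub>M M)"
    then obtain x \<omega> where q: "q = (x, \<omega>)" "x \<in> space N" "\<omega> \<in> space M"
      by (auto simp: space_pair_measure)
    have "0 \<le> f x" using assms q by auto
    have "(\<lambda>n. real (grid n (f x)) / Suc n) \<longlonglongrightarrow> f x"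
    proof (rule tendsto_sandwich)
      show "\<forall>\<^sub>F n in sequentially. f x - 1 / Suc n \<le> real (grid n (f x)) / Suc n"
      proof (rule always_eventually, rule allI)
        fix n
        have "f x * Suc n - 1 \<le> grid n (f x)"
          unfolding grid_def using \<open>0 \<le> f x\<close> by linarith
        then have "(f x * Suc n - 1) / Suc n \<le> real (grid n (f x)) / Suc n"
          by (intro divide_right_mono) auto
        then show "f x - 1 / Suc n \<le> real (grid n (f x)) / Suc n"
          by (simp add: diff_divide_distrib del: of_nat_Suc)
      qed
      show "\<forall>\<^sub>F n in sequentially. real (grid n (f x)) / Suc n \<le> f x"
      proof (rule always_eventually, rule allI)
        fix n
        have "0 \<le> f x * Suc n" using \<open>0 \<le> f x\<close> by simp
        then have "grid n (f x) \<le> f x * Suc n"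
          unfolding grid_def by linarith
        then show "real (grid n (f x)) / Suc n \<le> f x"
          by (simp add: field_simps)
      qed
      show "(\<lambda>n. f x - 1 / real (Suc n)) \<longlonglongrightarrow> f x"
        using tendsto_diff[OF tendsto_const LIMSEQ_Suc[OF lim_1_over_n]] by simp
    qed simp
    then have "(\<lambda>n. B (real (grid n (f x)) / Suc n) \<omega>) \<longlonglongrightarrow> B (f x) \<omega>"
      using \<open>0 \<le> f x\<close>
      by (intro continuous_on_tendsto_compose[OF paths[OF q(3)]]) auto
    then show "(\<lambda>n. (\<lambda>(x, \<omega>). B (real (grid n (f x)) / Suc n) \<omega>) q)
        \<longlonglongrightarrow> (\<lambda>(x, \<omega>). B (f x) \<omega>) q"
      by (simp add: q)
  qed
qed

section \<open>The closed form of the variance\<close>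

lemma lborel_integral_continuous:
  fixes f :: "real \<Rightarrow> real"
  assumes "continuous_on {a..b} f"
  shows "set_integrable lborel {a..b} f"
    and "(LBINT x:{a..b}. f x) = integral {a..b} f"
proof -
  show "set_integrable lborel {a..b} f"
    unfolding set_integrable_def by (intro borel_integrable_compact assms) simp
  then show "(LBINT x:{a..b}. f x) = integral {a..b} f"
    by (rule set_borel_integral_eq_integral)
qed

text \<open>The case \<open>t = 0\<close> is treated apart, since the constant summand \<open>exp t * B t\<close> of \<open>X\<close> is
  spread over \<open>{0..t}\<close> with density \<open>exp t / t\<close>.\<close>

lemma fBm_second_moment:
  fixes M :: "'a measure" and B :: "real \<Rightarrow> 'a \<Rightarrow> real" and H t :: real
  assumes fbm: "fractional_brownian_motion M H B" and H: "0 < H" and t: "0 \<le> t"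
  defines "a \<equiv> 2 * H"
  shows "(\<integral>\<omega>. (X B t \<omega>)\<^sup>2 \<partial>M) = exp t * t powr a +
    (exp (2 * t) * lower_exp_moment a t - upper_exp_moment a t) / 2"
proof -
  define R where "R s u = (s powr a + u powr a - \<bar>s - u\<bar> powr a) / 2" for s u :: real
  have a: "0 < a" using H by (simp add: a_def)
  from fbm have M: "prob_space M"
    and gp: "gaussian_process M {0..} B"
    and paths: "\<And>\<omega>. \<omega> \<in> space M \<Longrightarrow> continuous_on {0..} (\<lambda>t. B t \<omega>)"
    and cov: "\<And>s u. 0 \<le> s \<Longrightarrow> 0 \<le> u \<Longrightarrow> (\<integral>\<omega>. B s \<omega> * B u \<omega> \<partial>M) = R s u"
    by (auto simp: fractional_brownian_motion_def R_def a_def)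
  interpret prob_space M by fact
  have g: "gaussian_rv M (B s)" if "0 \<le> s" for s
    using gp[unfolded gaussian_process_def, rule_format, of "{s}" "\<lambda>_. 1"] that by simp
  have B_meas [measurable]: "B s \<in> borel_measurable M" if "0 \<le> s" for s
    using g[OF that] by (simp add: gaussian_rv_def)
  have B_sq: "integrable M (\<lambda>\<omega>. (B s \<omega>)\<^sup>2)" if "0 \<le> s" for s
    by (intro gaussian_rv_square_integrable M g that)
  have B_prod: "integrable M (\<lambda>\<omega>. B s \<omega> * B u \<omega>)" if "0 \<le> s" "0 \<le> u" for s u
    by (intro integrable_mult_of_squares B_meas B_sq that)
  show ?thesis
  proof (cases "t = 0")
    case True
    have "(LBINT s:{0..0}. exp s * B s \<omega>) = 0" for \<omega>
      by (subst lborel_integral_continuous(2)) auto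
    then have "X B 0 \<omega> = B 0 \<omega>" for \<omega>
      by (simp add: X_def)
    then show ?thesis
      using cov[of 0 0] True by (simp add: R_def power2_eq_square)
  next
    case False
    with t have t: "0 < t" by simp
    define N where "N = restrict_space lborel {0..t}"
    define c where "c = exp t / t"
    define Y where "Y s \<omega> = c * B t \<omega> - exp s * B s \<omega>" for s \<omega>
    define K where "K s u = c\<^sup>2 * t powr a - c * (exp u * R t u) - c * exp s * R t s + exp s * (exp u * R s u)" for s u
    have sN: "space N = {0..t}" by (simp add: N_def space_restrict_space)
    have N_int: "(\<integral>s. f s \<partial>N) = (LBINT s:{0..t}. f s)" for f :: "real \<Rightarrow> real"
      by (simp add: N_def integral_restrict_space set_lebesgue_integral_def)
    have N_fin: "finite_measure N"
      by (rule finite_measureI) (use t in \<open>simp add: N_def emeasure_restrict_space space_restrict_space\<close>)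
    have X_eq: "X B t \<omega> = (\<integral>s. Y s \<omega> \<partial>N)" if "\<omega> \<in> space M" for \<omega>
    proof -
      have cont: "continuous_on {0..t} (\<lambda>s. exp s * B s \<omega>)"
        by (intro continuous_intros continuous_on_subset[OF paths[OF that]]) auto
      have "(LBINT s:{0..t}. Y s \<omega>)
          = (LBINT s:{0..t}. c * B t \<omega>) - (LBINT s:{0..t}. exp s * B s \<omega>)"
        unfolding Y_def
        by (intro set_integral_diff(2) lborel_integral_continuous(1) continuous_on_const cont)
      also have "(LBINT s:{0..t}. c * B t \<omega>) = exp t * B t \<omega>"
        using t by (simp add: lborel_integral_continuous(2) c_def)
      finally show ?thesis by (simp add: X_def N_int)
    qed
    have Y_meas: "(\<lambda>(s, \<omega>). Y s \<omega>) \<in> borel_measurable (N \<Otimes>\<^sub>M M)"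
    proof -
      have id_meas: "(\<lambda>s. s) \<in> borel_measurable N"
        unfolding N_def by (rule measurable_restrict_space1) simp
      have "(\<lambda>(s, \<omega>). B s \<omega>) \<in> borel_measurable (N \<Otimes>\<^sub>M M)"
        by (rule continuous_paths_jointly_measurable[where f = "\<lambda>s. s"])
          (auto simp: sN intro: B_meas paths id_meas)
      moreover have "(\<lambda>q. exp (fst q)) \<in> borel_measurable (N \<Otimes>\<^sub>M M)"
        by (intro measurable_compose[OF measurable_fst]) (use id_meas in measurable)
      moreover have "(\<lambda>q. B t (snd q)) \<in> borel_measurable (N \<Otimes>\<^sub>M M)"
        using t by simp
      ultimately show ?thesis
        by (simp add: Y_def case_prod_unfold)
    qed
    have Y_cov: "(\<integral>\<omega>. Y s \<omega> * Y u \<omega> \<partial>M) = K s u" "integrable M (\<lambda>\<omega>. Y s \<omega> * Y u \<omega>)"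
      if su: "0 \<le> s" "0 \<le> u" for s u
    proof -
      have e: "(\<lambda>\<omega>. Y s \<omega> * Y u \<omega>) = (\<lambda>\<omega>. c\<^sup>2 * (B t \<omega> * B t \<omega>) - c * exp u * (B t \<omega> * B u \<omega>)
          - c * exp s * (B t \<omega> * B s \<omega>) + exp s * exp u * (B s \<omega> * B u \<omega>))"
        by (auto simp: Y_def algebra_simps power2_eq_square)
      show "integrable M (\<lambda>\<omega>. Y s \<omega> * Y u \<omega>)"
        unfolding e using t su
        by (intro Bochner_Integration.integrable_add Bochner_Integration.integrable_diff
            integrable_mult_right B_prod) auto
      show "(\<integral>\<omega>. Y s \<omega> * Y u \<omega> \<partial>M) = K s u"
        unfolding e using t su by (simp add: B_prod cov K_def) (simp add: R_def)
    qed
    have R_cont: "continuous_on {0..t} (\<lambda>u. R s u)" if "0 \<le> s" for s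
      unfolding R_def using a that by (intro continuous_intros continuous_on_powr_nonneg) auto
    have K_cont: "continuous_on {0..t} (K s)" if "0 \<le> s" for s
      unfolding K_def using that t by (intro continuous_intros R_cont) auto
    have "continuous_on {0..t} (\<lambda>s. R s s)"
      unfolding R_def using a by (simp, intro continuous_on_powr_nonneg) auto
    then have "continuous_on {0..t} (\<lambda>s. K s s)"
      unfolding K_def using t by (intro continuous_intros R_cont) auto
    then have "bounded ((\<lambda>s. K s s) ` {0..t})"
      by (intro compact_imp_bounded compact_continuous_image) auto
    then obtain C where "\<forall>s\<in>{0..t}. \<bar>K s s\<bar> \<le> C"
      by (auto simp: bounded_iff)
    then have C: "K s s \<le> C" if "s \<in> {0..t}" for s
      using that by (blast intro: abs_le_D1)
    have "(\<integral>\<omega>. (X B t \<omega>)\<^sup>2 \<partial>M) = (\<integral>\<omega>. (\<integral>s. Y s \<omega> \<partial>N)\<^sup>2 \<partial>M)"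
      by (intro Bochner_Integration.integral_cong) (auto simp: X_eq)
    also have "\<dots> = (\<integral>s. (\<integral>u. (\<integral>\<omega>. Y s \<omega> * Y u \<omega> \<partial>M) \<partial>N) \<partial>N)"
      by (rule second_moment_of_integral[OF N_fin _ Y_meas, where C = C])
        (use Y_cov C in \<open>auto simp: sN power2_eq_square intro: sigma_finite_measure_axioms\<close>)
    also have "\<dots> = (\<integral>s. (\<integral>u. K s u \<partial>N) \<partial>N)"
      by (intro Bochner_Integration.integral_cong refl) (auto simp: sN Y_cov)
    finally have EX: "(\<integral>\<omega>. (X B t \<omega>)\<^sup>2 \<partial>M) = (\<integral>s. (\<integral>u. K s u \<partial>N) \<partial>N)" .

    let ?G = "lower_exp_moment a" and ?F = "upper_exp_moment a"
    define J where "J s = ((exp t - 1) * s powr a + ?F t - exp s * (?G s + ?F (t - s))) / 2" for s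
    have J: "((\<lambda>u. exp u * R s u) has_integral J s) {0..t}" if "s \<in> {0..t}" for s
    proof -
      have "((\<lambda>u. (exp u * s powr a + exp u * u powr a - exp u * \<bar>s - u\<bar> powr a) / 2)
          has_integral J s) {0..t}"
        unfolding J_def using that a t
        by (intro has_integral_divide has_integral_diff has_integral_add has_integral_mult_left
            has_integral_exp has_integral_upper has_integral_exp_abs_diff) auto
      then show ?thesis by (simp add: R_def algebra_simps)
    qed
    have J_cont: "continuous_on {0..t} J"
      unfolding J_def using a
      by (intro continuous_intros continuous_on_powr_nonneg continuous_lower continuous_upper
          continuous_on_compose2[OF continuous_upper[OF a, of t]]) auto
    define L where "L s = t * (c\<^sup>2 * t powr a) - c * J t - t * (c * exp s * R t s) + exp s * J s" for s
    have L: "(\<integral>u. K s u \<partial>N) = L s" if s: "s \<in> {0..t}" for s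
    proof -
      have const: "((\<lambda>u. k) has_integral t * k) {0..t}" for k :: real
        using has_integral_const_real[of k 0 t] t by simp
      have "(K s has_integral L s) {0..t}"
        unfolding K_def L_def using t
        by (intro has_integral_diff has_integral_add has_integral_mult_right const J s) auto
      then show ?thesis
        using s by (simp add: N_int lborel_integral_continuous(2) K_cont integral_unique)
    qed
    have "(\<integral>s. (\<integral>u. K s u \<partial>N) \<partial>N) = (\<integral>s. L s \<partial>N)"
      by (intro Bochner_Integration.integral_cong refl) (auto simp: sN L)
    also have "\<dots> = integral {0..t} L"
      unfolding N_int L_def using t
      by (intro lborel_integral_continuous(2) continuous_intros R_cont J_cont) auto
    also have "\<dots> = exp (2 * t) * t powr a - 2 * exp t * J t
        + ((exp t - 1) * ?F t + ?F t * (exp t - 1) - (exp (2 * t) * ?G t - ?F t)) / 2"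
    proof (rule integral_unique)
      have const: "((\<lambda>u. k) has_integral t * k) {0..t}" for k :: real
        using has_integral_const_real[of k 0 t] t by simp
      have "((\<lambda>s. ((exp t - 1) * (exp s * s powr a) + ?F t * exp s
              - exp s * (exp s * (?G s + ?F (t - s)))) / 2) has_integral
          ((exp t - 1) * ?F t + ?F t * (exp t - 1) - (exp (2 * t) * ?G t - ?F t)) / 2) {0..t}"
        using a t
        by (intro has_integral_divide has_integral_diff has_integral_add has_integral_mult_right
            has_integral_exp has_integral_upper has_integral_exp_abs_diff_outer) auto
      then have Q: "((\<lambda>s. exp s * J s) has_integral
          ((exp t - 1) * ?F t + ?F t * (exp t - 1) - (exp (2 * t) * ?G t - ?F t)) / 2) {0..t}"
        by (simp add: J_def algebra_simps)
      have "((\<lambda>s. (t * (c\<^sup>2 * t powr a) - c * J t) - (t * c) * (exp s * R t s) + exp s * J s) has_integral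
          t * (t * (c\<^sup>2 * t powr a) - c * J t) - (t * c) * J t
          + ((exp t - 1) * ?F t + ?F t * (exp t - 1) - (exp (2 * t) * ?G t - ?F t)) / 2) {0..t}"
        using t by (intro has_integral_diff has_integral_add has_integral_mult_right const J Q) auto
      moreover have "t * c = exp t" using t by (simp add: c_def)
      moreover have "t * (t * (c\<^sup>2 * t powr a) - c * J t) = (t * c)\<^sup>2 * t powr a - (t * c) * J t"
        by (simp add: power2_eq_square algebra_simps)
      moreover have "(\<lambda>s. (t * (c\<^sup>2 * t powr a) - c * J t) - (t * c) * (exp s * R t s) + exp s * J s) = L"
        by (auto simp: L_def algebra_simps)
      ultimately have "(L has_integral (exp t)\<^sup>2 * t powr a - exp t * J t - exp t * J t
        + ((exp t - 1) * ?F t + ?F t * (exp t - 1) - (exp (2 * t) * ?G t - ?F t)) / 2) {0..t}"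
        by (simp only:)
      then show "(L has_integral exp (2 * t) * t powr a - 2 * exp t * J t
        + ((exp t - 1) * ?F t + ?F t * (exp t - 1) - (exp (2 * t) * ?G t - ?F t)) / 2) {0..t}"
        unfolding exp_double by (simp add: mult_ac)
    qed
    also have "\<dots> = exp t * t powr a + (exp (2 * t) * ?G t - ?F t) / 2"
      unfolding exp_double by (simp add: J_def power2_eq_square field_simps)
    finally show ?thesis using EX by simp
  qed
qed

section \<open>Monotonicity\<close>

text \<open>In the derivative the terms \<open>exp x * x powr a\<close> of the two summands cancel, which leaves only
  the nonnegative contribution of differentiating \<open>exp (2 * x)\<close>.\<close>

lemma exp_moment_combination_mono:
  assumes a: "0 < a" and "0 \<le> r" "r \<le> t"
  shows "exp (2 * r) * lower_exp_moment a r - upper_exp_moment a r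
    \<le> exp (2 * t) * lower_exp_moment a t - upper_exp_moment a t"
proof (rule DERIV_nonneg_imp_increasing_open[OF \<open>r \<le> t\<close>])
  fix x assume "r < x" "x < t"
  with \<open>0 \<le> r\<close> have x: "0 < x" by simp
  have e: "exp (2 * x) = exp x * exp x" "exp (x * 2) = exp x * exp x"
    by (simp_all flip: exp_add)
  have "((\<lambda>x. exp (2 * x) * lower_exp_moment a x - upper_exp_moment a x) has_real_derivative
      2 * (exp (2 * x) * lower_exp_moment a x)) (at x)"
    by (rule derivative_eq_intros deriv_lower[OF a] deriv_upper[OF a] refl x)+
      (simp_all add: e exp_minus field_simps)
  moreover have "0 \<le> lower_exp_moment a x"
    unfolding lower_exp_moment_def by (cases "(\<lambda>v. exp (- v) * v powr a) integrable_on {0..x}")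
      (auto intro: integral_nonneg simp: not_integrable_integral)
  ultimately show "\<exists>y. ((\<lambda>x. exp (2 * x) * lower_exp_moment a x - upper_exp_moment a x)
      has_real_derivative y) (at x) \<and> 0 \<le> y"
    by (intro exI[of _ "2 * (exp (2 * x) * lower_exp_moment a x)"]) simp
next
  show "continuous_on {r..t} (\<lambda>x. exp (2 * x) * lower_exp_moment a x - upper_exp_moment a x)"
    using \<open>0 \<le> r\<close>
    by (intro continuous_intros continuous_on_subset[OF continuous_lower[OF a, of t]]
        continuous_on_subset[OF continuous_upper[OF a, of t]]) auto
qed

theorem mainTheorem4:
  fixes M :: "'a measure" and B :: "real \<Rightarrow> 'a \<Rightarrow> real" and H :: real
  assumes "H \<in> {0..1}"
    and "H \<in> {0<..<1} \<Longrightarrow> fractional_brownian_motion M H B"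
  shows "strict_mono_on {0..} (\<lambda>t. V M B H t)"
proof (rule strict_mono_onI)
  fix r t :: real
  assume "r \<in> {0..}" "t \<in> {0..}" "r < t"
  then have rt: "0 \<le> r" "r < t" "0 < t" by auto
  consider "H = 0" | "H = 1" | "0 < H" "H < 1" using assms(1) by force
  then show "V M B H r < V M B H t"
  proof cases
    case 1
    have "0 < exp (2 * t) + 1" by (intro add_pos_pos) auto
    with 1 rt show ?thesis by (auto simp: V_def)
  next
    case 2
    have "(exp r - 1)\<^sup>2 < (exp t - 1)\<^sup>2"
      using rt by (intro power_strict_mono) auto
    with 2 show ?thesis by (simp add: V_def)
  next
    case 3
    then have fbm: "fractional_brownian_motion M H B" using assms(2) by simp
    have V: "V M B H x = exp x * x powr (2 * H)
        + (exp (2 * x) * lower_exp_moment (2 * H) x - upper_exp_moment (2 * H) x) / 2"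
      if "0 \<le> x" for x
      using 3 fBm_second_moment[OF fbm _ that] by (simp add: V_def)
    have "exp r * r powr (2 * H) < exp t * t powr (2 * H)"
      using rt 3 by (intro mult_strict_mono powr_less_mono2) auto
    moreover have "exp (2 * r) * lower_exp_moment (2 * H) r - upper_exp_moment (2 * H) r
        \<le> exp (2 * t) * lower_exp_moment (2 * H) t - upper_exp_moment (2 * H) t"
      using rt 3 by (intro exp_moment_combination_mono) auto
    ultimately show ?thesis
      using rt by (auto simp: V intro!: add_less_le_mono divide_right_mono)
  qed
qed

end
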